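(* For every $\delta>0$, there exist a family $(v^\varepsilon)$ of smooth (in fact, rational in $z$) solutions of the cubic Szeg\H{o} equation $i\partial_t v=\mathbb{P}(|v|^2v)$ on the circle $\mathbb{T}$ and a family $(t^\varepsilon)$ of positive times such that, as $\varepsilon\to0$, $$t^\varepsilon\to0,\qquad \|v^\varepsilon(0)\|_{W^{-\delta,2}}\to0,\qquad |\langle v^\varepsilon(t^\varepsilon),\mathbf{1}\rangle|\to+\infty.$$
   Context: $H^2$ is the Hardy space on the unit circle $\mathbb{T}$ with inner product $\langle\cdot,\cdot\rangle$ (normalised Lebesgue measure), $\mathbb{P}$ is the orthogonal projection from $L^2(\mathbb{T})$ onto $H^2$, and $\mathbf{1}\in H^2$ is the function identically equal to $1$, so $\langle v,\mathbf{1}\rangle=\widehat v_0$. $W^{-\delta,2}(\mathbb{T})$ is the $L^2$-based Sobolev space of order $-\delta$, with norm $\|v\|_{W^{-\delta,2}}^2=\sum_n(1+n^2)^{-\delta}|\widehat v_n|^2$, where $\widehat v_n$ are the Fourier coefficients. Solutions $v=v(t,z)$ take values in $H^2$ for each time $t$, and $v^\varepsilon(t)$ denotes $v^\varepsilon(t,\cdot)$. *)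

theory Defs
  imports "HOL-Analysis.Analysis"
begin

text \<open>Normalised Lebesgue measure on the unit circle.  Functions on the circle are represented by
  functions \<^typ>\<open>complex \<Rightarrow> complex\<close>; only their values on \<^term>\<open>sphere (0::complex) 1\<close> matter,
  also for measurability.\<close>

definition circle_measure :: "complex measure" where
  "circle_measure =
     distr (uniform_measure lborel {0..<2 * pi}) (restrict_space borel (sphere 0 1)) cis"

definition circle_L2 :: "(complex \<Rightarrow> complex) set" where
  "circle_L2 = {f. f \<in> borel_measurable circle_measure \<and>
                   integrable circle_measure (\<lambda>z. (cmod (f z))\<^sup>2)}"

definition circle_inner :: "(complex \<Rightarrow> complex) \<Rightarrow> (complex \<Rightarrow> complex) \<Rightarrow> complex" where
  "circle_inner f g = (\<integral>z. f z * cnj (g z) \<partial>circle_measure)"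

definition fourier_coeff :: "(complex \<Rightarrow> complex) \<Rightarrow> int \<Rightarrow> complex" where
  "fourier_coeff f n = circle_inner f (\<lambda>z. z powi n)"

definition hardy_H2 :: "(complex \<Rightarrow> complex) set" where
  "hardy_H2 = {f \<in> circle_L2. \<forall>n<0. fourier_coeff f n = 0}"

text \<open>Elements of \<open>L\<^sup>2\<close> are not quotiented by equality almost everywhere, so the orthogonal
  projection onto \<open>H\<^sup>2\<close> is a relation: \<open>g\<close> is a representative of the projection of \<open>f\<close>.\<close>

definition szego_projection :: "(complex \<Rightarrow> complex) \<Rightarrow> (complex \<Rightarrow> complex) \<Rightarrow> bool" where
  "szego_projection f g \<longleftrightarrow>
     f \<in> circle_L2 \<and> g \<in> hardy_H2 \<and> (\<forall>h\<in>hardy_H2. circle_inner (\<lambda>z. f z - g z) h = 0)"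

text \<open>For \<open>s < 0\<close> and \<open>f\<close> in \<open>L\<^sup>2\<close> the series always converges.\<close>

definition sobolev_norm :: "real \<Rightarrow> (complex \<Rightarrow> complex) \<Rightarrow> real" where
  "sobolev_norm s f =
     sqrt (\<Sum>\<^sub>\<infinity>n\<in>(UNIV::int set). (1 + (real_of_int n)\<^sup>2) powr s * (cmod (fourier_coeff f n))\<^sup>2)"

primrec Ck :: "nat \<Rightarrow> ('a::euclidean_space \<Rightarrow> 'b::real_normed_vector) \<Rightarrow> bool" where
  "Ck 0 f \<longleftrightarrow> continuous_on UNIV f"
| "Ck (Suc k) f \<longleftrightarrow>
     (\<exists>f'. (\<forall>x. (f has_derivative f' x) (at x)) \<and> (\<forall>u. Ck k (\<lambda>x. f' x u)))"

text \<open>\<open>C\<^sup>\<infinity>\<close> jointly in time and in the angular variable.\<close>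

definition smooth_time_circle :: "(real \<Rightarrow> complex \<Rightarrow> complex) \<Rightarrow> bool" where
  "smooth_time_circle v \<longleftrightarrow> (\<forall>k. Ck k (\<lambda>(t::real, \<theta>::real). v t (cis \<theta>)))"

text \<open>Smooth solutions, global in time, with \<open>v'\<close> the pointwise time derivative at time \<open>t\<close>.\<close>

definition smooth_szego_solution :: "(real \<Rightarrow> complex \<Rightarrow> complex) \<Rightarrow> bool" where
  "smooth_szego_solution v \<longleftrightarrow>
     smooth_time_circle v \<and> (\<forall>t. v t \<in> hardy_H2) \<and>
     (\<forall>t. \<exists>v'. (\<forall>z\<in>sphere 0 1. ((\<lambda>s. v s z) has_vector_derivative v' z) (at t)) \<and>
               szego_projection (\<lambda>z. of_real ((cmod (v t z))\<^sup>2) * v t z) (\<lambda>z. \<i> * v' z))"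

definition rational_on_circle :: "(complex \<Rightarrow> complex) \<Rightarrow> bool" where
  "rational_on_circle f \<longleftrightarrow>
     (\<exists>p q :: complex poly. \<forall>z\<in>sphere 0 1. poly q z \<noteq> 0 \<and> f z = poly p z / poly q z)"

end

theory Submission imports Defs begin

text \<open>
  The growth comes from an instability of the solution \<open>exp (- \<i> t) z\<close>.  If its initial datum is perturbed to
  \<open>z + e\<close>, the Szego flow can be integrated explicitly: the solution keeps the form
  \<open>(a z + b) / (1 - p z)\<close> with \<open>\<bar>p\<bar> < 1\<close>, and after a time of order \<open>1 / e\<close> its mean \<open>b\<close>, initially \<open>e\<close>,
  has modulus at least \<open>1\<close> (\<open>cmod_orbit_shift_peak\<close>), no matter how small \<open>e\<close> is.

  Two symmetries convert this into norm inflation.  Replacing \<open>v(t,z)\<close> by \<open>l v(l\<^sup>2 t, z)\<close> with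
  \<open>e\<^sup>-\<^sup>1\<^sup>/\<^sup>2 \<ll> l \<ll> e\<^sup>-\<^sup>1\<close> makes the time short and the final mean large while the initial mean \<open>l e\<close> still tends
  to zero.  Replacing \<open>z\<close> by \<open>z\<^sup>N\<close> leaves means unchanged and gives the remaining part \<open>l z\<^sup>N\<close> of the datum a norm
  of order \<open>l N\<^sup>-\<^sup>\<delta>\<close> in \<open>W\<^sup>-\<^sup>\<delta>\<^sup>,\<^sup>2\<close>, which tends to zero once \<open>N\<close> is large enough.

  That the explicit formula solves the equation is a partial fraction decomposition on the circle.  The
  cubic term \<open>\<bar>v\<bar>\<^sup>2 v\<close> has a double pole outside the closed disc and a simple pole inside it.  The part
  with the outer pole equals \<open>\<i> v'\<close> (\<open>szego_orbit_has_derivative\<close>, \<open>szego_orbit_cubic\<close>) and belongs to \<open>H\<^sup>2\<close>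
  (\<open>hardy_H2_divide\<close>); the part with the inner pole is orthogonal to \<open>H\<^sup>2\<close> (\<open>circle_inner_coanalytic\<close>).
\<close>

section \<open>Fourier analysis on the circle\<close>

lemma cis_measurable:
  "cis \<in> measurable (uniform_measure lborel {0..<2*pi}) (restrict_space borel (sphere 0 1))"
  by (intro measurable_restrict_space2)
    (auto intro!: borel_measurable_continuous_onI continuous_intros simp: measurable_cong_sets[OF sets_uniform_measure refl])

lemma finite_measure_circle: "finite_measure circle_measure"
proof -
  have "emeasure (uniform_measure lborel {0..<2*pi}) UNIV < \<infinity>"
    by (subst emeasure_uniform_measure) (auto simp: divide_ennreal[symmetric])
  then have "finite_measure (uniform_measure lborel {0..<2*pi})"
    by (intro finite_measureI) (simp add: less_top)
  then show ?thesis unfolding circle_measure_def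
    by (rule finite_measure.finite_measure_distr[OF _ cis_measurable])
qed

interpretation circle: finite_measure circle_measure by (rule finite_measure_circle)

lemma space_circle [simp]: "space circle_measure = sphere 0 1"
  by (simp add: circle_measure_def space_restrict_space)

lemma measurable_circle_continuous:
  "continuous_on (sphere 0 1) f \<Longrightarrow> f \<in> borel_measurable circle_measure" for f :: "complex \<Rightarrow> complex"
  using borel_measurable_continuous_on_restrict[of "sphere 0 1" f]
  by (simp add: circle_measure_def measurable_cong_sets[OF sets_distr refl])

lemma integral_circle_powi: "(\<integral>z. z powi k \<partial>circle_measure) = (if k = 0 then 1 else 0)"
proof -
  have cis_meas: "(\<lambda>x. cis x powi k) \<in> borel_measurable lborel"
    by (auto intro!: borel_measurable_continuous_onI continuous_intros)
  have "(\<lambda>z::complex. z powi k) \<in> borel_measurable (restrict_space borel (sphere 0 1))"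
    by (intro borel_measurable_continuous_on_restrict continuous_intros) auto
  then have "(\<integral>z. z powi k \<partial>circle_measure) = (\<integral>x. cis x powi k \<partial>uniform_measure lborel {0..<2*pi})"
    unfolding circle_measure_def by (intro integral_distr cis_measurable)
  also have "\<dots> = (\<integral>x. (indicator {0..<2*pi} x / (2*pi)) *\<^sub>R cis x powi k \<partial>lborel)"
  proof -
    have "uniform_measure lborel {0..<2*pi} = density lborel (\<lambda>x. ennreal (indicator {0..<2*pi} x / (2*pi)))"
      unfolding uniform_measure_def
      by (intro arg_cong[of _ _ "density lborel"] ext) (auto simp: indicator_def divide_ennreal[symmetric])
    then show ?thesis using cis_meas by (simp add: integral_density)
  qed
  also have "\<dots> = (1/(2*pi)) *\<^sub>R (\<integral>x. indicator {0..<2*pi} x *\<^sub>R cis x powi k \<partial>lborel)"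
    by (subst integral_scaleR_right[symmetric]) (auto simp: indicator_def intro!: Bochner_Integration.integral_cong)
  \<comment> \<open>The added endpoint is a null set; the fundamental theorem of calculus wants a closed interval.\<close>
  also have "(\<integral>x. indicator {0..<2*pi} x *\<^sub>R cis x powi k \<partial>lborel)
     = (\<integral>x. indicator {0..2*pi} x *\<^sub>R cis x powi k \<partial>lborel)"
    using cis_meas
    by (intro integral_cong_AE)
      (auto intro!: AE_I[of _ _ "{2*pi}"] simp: indicator_def)
  also have "\<dots> = (if k = 0 then 2*pi else 0)"
  proof (cases "k = 0")
    case False
    have "(\<integral>x. indicator {0..2*pi} x *\<^sub>R cis x powi k \<partial>lborel) = cis (2*pi) powi k / (\<i>*k) - cis 0 powi k / (\<i>*k)"
    proof (rule integral_FTC_Icc)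
      fix x :: real
      have "cis y powi k = exp (\<i> * k * y)" for y by (simp add: cis_conv_exp exp_power_int mult_ac)
      then show "((\<lambda>x. cis x powi k / (\<i>*k)) has_vector_derivative cis x powi k) (at x within {0..2*pi})"
        using False by (auto intro!: derivative_eq_intros has_vector_derivative_real_field)
    qed (auto intro!: continuous_intros)
    then show ?thesis using False by simp
  qed (simp add: scaleR_conv_of_real)
  finally show ?thesis by (simp add: scaleR_conv_of_real)
qed

lemma circle_inner_eqI:
  assumes "\<And>z. cmod z = 1 \<Longrightarrow> f z * cnj (g z) = f' z * cnj (g' z)"
  shows "circle_inner f g = circle_inner f' g'"
  unfolding circle_inner_def by (intro Bochner_Integration.integral_cong) (auto simp: assms)

lemma circle_continuous_bounded:
  fixes f :: "complex \<Rightarrow> complex"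
  assumes "continuous_on (sphere 0 1) f"
  shows "\<exists>B. \<forall>z. cmod z = 1 \<longrightarrow> cmod (f z) \<le> B"
  using compact_imp_bounded[OF compact_continuous_image[OF assms compact_sphere]]
  by (simp add: bounded_iff) (metis mem_sphere_0)

text \<open>This is where finiteness of the measure enters: \<open>x \<le> 1 + x\<^sup>2\<close>, and constants are integrable.\<close>

lemma circle_L2_integrable:
  assumes "f \<in> circle_L2" shows "integrable circle_measure f"
proof (rule Bochner_Integration.integrable_bound)
  show "integrable circle_measure (\<lambda>z. 1 + (cmod (f z))\<^sup>2)"
    using assms by (auto simp: circle_L2_def)
  have "x \<le> 1 + x\<^sup>2" for x :: real
    using sum_power2_ge_zero[of "x - 1/2" 0] by (simp add: power2_eq_square algebra_simps)
  then show "AE z in circle_measure. norm (f z) \<le> norm (1 + (cmod (f z))\<^sup>2)"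
    by (intro AE_I2) (metis abs_of_nonneg real_norm_def zero_le_power2 add_nonneg_nonneg zero_le_one)
qed (use assms in \<open>auto simp: circle_L2_def\<close>)

lemma circle_L2_mult_continuous:
  assumes "f \<in> circle_L2" "continuous_on (sphere 0 1) g"
  shows "(\<lambda>z. f z * g z) \<in> circle_L2"
proof -
  obtain B where B: "\<And>z. cmod z = 1 \<Longrightarrow> cmod (g z) \<le> B"
    using circle_continuous_bounded[OF assms(2)] by blast
  have m: "(\<lambda>z. f z * g z) \<in> borel_measurable circle_measure"
    using assms measurable_circle_continuous[OF assms(2)] by (auto simp: circle_L2_def)
  have "integrable circle_measure (\<lambda>z. (cmod (f z * g z))\<^sup>2)"
  proof (rule Bochner_Integration.integrable_bound)
    show "integrable circle_measure (\<lambda>z. (cmod (f z))\<^sup>2 * B\<^sup>2)"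
      using assms by (auto simp: circle_L2_def)
    show "AE z in circle_measure. norm ((cmod (f z * g z))\<^sup>2) \<le> norm ((cmod (f z))\<^sup>2 * B\<^sup>2)"
      using B by (intro AE_I2)
        (auto simp: norm_mult power_mult_distrib intro!: mult_left_mono power_mono)
  qed (use m in measurable)
  then show ?thesis using m by (simp add: circle_L2_def)
qed

lemma circle_L2_add:
  assumes "f \<in> circle_L2" "g \<in> circle_L2"
  shows "(\<lambda>z. f z + g z) \<in> circle_L2"
proof -
  have m: "(\<lambda>z. f z + g z) \<in> borel_measurable circle_measure"
    using assms by (auto simp: circle_L2_def)
  have "(cmod (a + b))\<^sup>2 \<le> 2 * (cmod a)\<^sup>2 + 2 * (cmod b)\<^sup>2" for a b
  proof -
    have "(cmod (a + b))\<^sup>2 \<le> (cmod a + cmod b)\<^sup>2"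
      by (intro power_mono norm_triangle_ineq) auto
    also have "\<dots> \<le> 2 * (cmod a)\<^sup>2 + 2 * (cmod b)\<^sup>2"
      using zero_le_power2[of "cmod a - cmod b"] by (simp add: power2_eq_square algebra_simps)
    finally show ?thesis .
  qed
  then have bound: "norm ((cmod (f z + g z))\<^sup>2) \<le> norm (2 * (cmod (f z))\<^sup>2 + 2 * (cmod (g z))\<^sup>2)" for z
    by simp
  have "integrable circle_measure (\<lambda>z. (cmod (f z + g z))\<^sup>2)"
  proof (rule Bochner_Integration.integrable_bound)
    show "integrable circle_measure (\<lambda>z. 2 * (cmod (f z))\<^sup>2 + 2 * (cmod (g z))\<^sup>2)"
      using assms by (auto simp: circle_L2_def)
  qed (use m in measurable, use bound in auto)
  then show ?thesis using m by (simp add: circle_L2_def)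
qed

lemma circle_L2_continuous:
  assumes "continuous_on (sphere 0 1) f" shows "f \<in> circle_L2"
proof -
  have "(\<lambda>_. 1) \<in> circle_L2" by (simp add: circle_L2_def)
  from circle_L2_mult_continuous[OF this assms] show ?thesis by simp
qed

lemma continuous_on_circle_powi: "continuous_on (sphere 0 1) (\<lambda>z::complex. z powi n)"
  by (intro continuous_intros) auto

lemma cnj_eq_inverse_circle: "cmod z = 1 \<Longrightarrow> cnj z = inverse z"
  using complex_norm_square[of z] by (intro inverse_unique[symmetric]) simp

lemma cnj_powi_circle: "cmod z = 1 \<Longrightarrow> cnj z powi n = z powi (- n)"
  by (simp add: cnj_eq_inverse_circle power_int_inverse power_int_minus)

lemma fourier_coeff_altdef: "fourier_coeff f n = (\<integral>z. f z * z powi (- n) \<partial>circle_measure)"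
  unfolding fourier_coeff_def circle_inner_def
  by (intro Bochner_Integration.integral_cong) (auto simp: cnj_powi_circle)

lemma integrable_fourier:
  assumes "f \<in> circle_L2" shows "integrable circle_measure (\<lambda>z. f z * z powi n)"
  by (intro circle_L2_integrable circle_L2_mult_continuous assms continuous_on_circle_powi)

lemma fourier_coeff_add:
  assumes "f \<in> circle_L2" "g \<in> circle_L2"
  shows "fourier_coeff (\<lambda>z. f z + g z) n = fourier_coeff f n + fourier_coeff g n"
  unfolding fourier_coeff_altdef
  by (simp add: distrib_right integrable_fourier assms)

lemma fourier_coeff_cmult: "fourier_coeff (\<lambda>z. c * f z) n = c * fourier_coeff f n"
  unfolding fourier_coeff_altdef by (simp add: mult.assoc)

lemma fourier_coeff_shift: "fourier_coeff (\<lambda>z. f z * z ^ m) n = fourier_coeff f (n - int m)"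
  unfolding fourier_coeff_altdef
proof (intro Bochner_Integration.integral_cong refl)
  fix z assume "z \<in> space circle_measure"
  then have "z \<noteq> 0" by auto
  then have "z ^ m * z powi (- n) = z powi (- (n - int m))"
    by (simp flip: power_int_add power_int_of_nat)
  then show "f z * z ^ m * z powi (- n) = f z * z powi (- (n - int m))" by (simp add: mult.assoc)
qed

lemma fourier_coeff_power: "fourier_coeff (\<lambda>z. z ^ m) n = (if n = int m then 1 else 0)"
  using fourier_coeff_shift[of "\<lambda>_. 1" m n] by (simp add: fourier_coeff_altdef integral_circle_powi)

lemma fourier_coeff_cong:
  assumes "\<And>z. cmod z = 1 \<Longrightarrow> f z = g z" shows "fourier_coeff f n = fourier_coeff g n"
  unfolding fourier_coeff_def by (intro circle_inner_eqI) (simp add: assms)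

section \<open>Stability of the Hardy space under division by a zero-free binomial\<close>

lemma hardy_H2_add: "f \<in> hardy_H2 \<Longrightarrow> g \<in> hardy_H2 \<Longrightarrow> (\<lambda>z. f z + g z) \<in> hardy_H2"
  by (simp add: hardy_H2_def circle_L2_add fourier_coeff_add)

lemma hardy_H2_cmult: "f \<in> hardy_H2 \<Longrightarrow> (\<lambda>z. c * f z) \<in> hardy_H2"
  using circle_L2_mult_continuous[of f "\<lambda>_. c"] fourier_coeff_cmult[of c f]
  by (simp add: hardy_H2_def mult.commute[of c])

lemma hardy_H2_power: "(\<lambda>z. z ^ m) \<in> hardy_H2"
  by (auto simp: hardy_H2_def fourier_coeff_power intro!: circle_L2_continuous continuous_intros)

lemma hardy_H2_const: "(\<lambda>_. c) \<in> hardy_H2"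
  using hardy_H2_cmult[OF hardy_H2_power[of 0]] by simp

lemma one_minus_mult_nonzero:
  fixes a b :: complex
  assumes "cmod a < 1" "cmod b = 1" shows "1 - a * b \<noteq> 0"
proof
  assume "1 - a * b = 0"
  then have "cmod (a * b) = 1" by (simp flip: eq_iff_diff_eq_0)
  with assms show False by (simp add: norm_mult)
qed

lemma circle_L2_divide:
  assumes "f \<in> circle_L2" "cmod p < 1"
  shows "(\<lambda>z. f z / (1 - p * z ^ N)) \<in> circle_L2"
proof -
  have "continuous_on (sphere 0 1) (\<lambda>z. 1 / (1 - p * z ^ N))"
    using one_minus_mult_nonzero[OF assms(2)] by (intro continuous_intros) (auto simp: norm_power)
  from circle_L2_mult_continuous[OF assms(1) this] show ?thesis by simp
qed

text \<open>The function \<open>g = f / (1 - p z\<^sup>N)\<close> satisfies \<open>g = f + p z\<^sup>N g\<close>, so at negative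
  frequencies its Fourier coefficients obey \<open>g\<^sub>n = p g\<^sub>n\<^sub>-\<^sub>N\<close>.  Iterating multiplies a bounded quantity by
  arbitrarily high powers of \<open>p\<close>, which forces \<open>g\<^sub>n = 0\<close>.  Three facts rest on
  this: membership of the rational functions, the vanishing of their coanalytic
  remainder under the projection, and the value of their mean.\<close>

lemma hardy_H2_divide:
  assumes f: "f \<in> hardy_H2" and p: "cmod p < 1"
  shows "(\<lambda>z. f z / (1 - p * z ^ N)) \<in> hardy_H2"
proof -
  define g where "g = (\<lambda>z. f z / (1 - p * z ^ N))"
  have fL: "f \<in> circle_L2" using f by (simp add: hardy_H2_def)
  have gL: "g \<in> circle_L2" unfolding g_def by (rule circle_L2_divide[OF fL p])
  have pg: "(\<lambda>z. c * (g z * z ^ N)) \<in> circle_L2" for c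
    using circle_L2_mult_continuous[OF gL, of "\<lambda>z. c * z ^ N"]
    by (simp add: continuous_intros mult.left_commute)
  have step: "fourier_coeff g n = p * fourier_coeff g (n - int N)" if "n < 0" for n
  proof -
    have "fourier_coeff g n = fourier_coeff (\<lambda>z. f z + p * (g z * z ^ N)) n"
    proof (intro fourier_coeff_cong)
      fix z :: complex assume "cmod z = 1"
      then have "1 - p * z ^ N \<noteq> 0" by (intro one_minus_mult_nonzero[OF p]) (simp add: norm_power)
      then show "g z = f z + p * (g z * z ^ N)" by (simp add: g_def divide_simps) (simp add: algebra_simps)
    qed
    also have "\<dots> = fourier_coeff f n + p * fourier_coeff g (n - int N)"
      by (simp add: fourier_coeff_add fL pg fourier_coeff_cmult fourier_coeff_shift)
    finally show ?thesis using f that by (simp add: hardy_H2_def)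
  qed
  define B where "B = (\<integral>z. cmod (g z) \<partial>circle_measure)"
  have bound: "cmod (fourier_coeff g n) \<le> B" for n
  proof -
    have "cmod (fourier_coeff g n) \<le> (\<integral>z. cmod (g z * z powi (- n)) \<partial>circle_measure)"
      unfolding fourier_coeff_altdef by (rule integral_norm_bound)
    also have "\<dots> = B" unfolding B_def
      by (intro Bochner_Integration.integral_cong) (auto simp: norm_mult norm_power_int)
    finally show ?thesis .
  qed
  have "fourier_coeff g n = 0" if n: "n < 0" for n
  proof -
    have "fourier_coeff g n = p ^ M * fourier_coeff g (n - int (M * N))" for M
    proof (induction M)
      case (Suc M)
      have "fourier_coeff g (n - int (M * N)) = p * fourier_coeff g (n - int (M * N) - int N)"
        using n by (intro step) (smt (verit) of_nat_0_le_iff)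
      then show ?case using Suc by (simp add: algebra_simps)
    qed simp
    then have "cmod (fourier_coeff g n) \<le> cmod p ^ M * B" for M
      by (metis bound mult_left_mono norm_ge_zero norm_mult norm_power zero_le_power)
    moreover have "(\<lambda>M. cmod p ^ M * B) \<longlonglongrightarrow> 0"
      using tendsto_mult_left_zero[OF LIMSEQ_realpow_zero[OF norm_ge_zero p]] by simp
    ultimately have "cmod (fourier_coeff g n) \<le> 0"
      by (intro LIMSEQ_le_const) auto
    then show ?thesis by simp
  qed
  then show ?thesis using gL by (simp add: hardy_H2_def g_def)
qed

text \<open>Up to the factor \<open>c\<close> the integrand is the conjugate of \<open>z\<^sup>N h / (1 - p z\<^sup>N)\<close>, an element of \<open>H\<^sup>2\<close> without constant
  term.  On the circle \<open>cnj (z / (1 - p z)) = 1 / (z - cnj p)\<close>, so this is, for \<open>N = 1\<close>, the statement that a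
  simple pole inside the disc is removed by the projection.\<close>

lemma circle_inner_coanalytic:
  assumes h: "h \<in> hardy_H2" and p: "cmod p < 1" and "N > 0"
  shows "circle_inner (\<lambda>z. c * cnj (z ^ N / (1 - p * z ^ N))) h = 0"
proof -
  have "circle_inner (\<lambda>z. c * cnj (z ^ N / (1 - p * z ^ N))) h
      = c * (\<integral>z. cnj (h z / (1 - p * z ^ N) * z powi (- (- int N))) \<partial>circle_measure)"
    unfolding circle_inner_def by (subst integral_mult_right_zero[symmetric]) (simp add: mult_ac)
  also have "\<dots> = c * cnj (fourier_coeff (\<lambda>z. h z / (1 - p * z ^ N)) (- int N))"
    unfolding fourier_coeff_altdef by (simp del: complex_cnj_mult complex_cnj_divide)
  also have "\<dots> = 0" using hardy_H2_divide[OF h p, of N] \<open>N > 0\<close> by (simp add: hardy_H2_def)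
  finally show ?thesis .
qed

section \<open>Calculus of smooth functions\<close>

lemma Ck_Suc_imp_Ck: "Ck (Suc k) f \<Longrightarrow> Ck k f"
proof (induction k arbitrary: f)
  case 0
  then show ?case
    by (auto intro!: continuous_at_imp_continuous_on dest: has_derivative_continuous)
next
  case (Suc k)
  then obtain f' where "\<forall>x. (f has_derivative f' x) (at x)" "\<forall>u. Ck (Suc k) (\<lambda>x. f' x u)"
    by (subst (asm) Ck.simps) blast
  then show ?case using Suc.IH by (subst Ck.simps) blast
qed

lemma Ck_const: "Ck k (\<lambda>_. c)"
  by (induction k arbitrary: c) (auto intro!: exI[of _ "\<lambda>_ _. 0"])

lemma Ck_add: "Ck k f \<Longrightarrow> Ck k g \<Longrightarrow> Ck k (\<lambda>x. f x + g x)"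
proof (induction k arbitrary: f g)
  case 0
  then show ?case by (auto intro: continuous_intros)
next
  case (Suc k)
  from Suc.prems obtain f' g' where d:
    "\<And>x. (f has_derivative f' x) (at x)" "\<And>u. Ck k (\<lambda>x. f' x u)"
    "\<And>x. (g has_derivative g' x) (at x)" "\<And>u. Ck k (\<lambda>x. g' x u)" by auto
  show ?case unfolding Ck.simps
    by (rule exI[of _ "\<lambda>x u. f' x u + g' x u"]) (auto intro!: has_derivative_add d Suc.IH)
qed

text \<open>The product rule at order \<open>k + 1\<close> involves the undifferentiated factors at order \<open>k\<close>, which is why
  the lowering lemma \<open>Ck_Suc_imp_Ck\<close> is required.\<close>

lemma Ck_mult:
  fixes f g :: "'a::euclidean_space \<Rightarrow> 'b::real_normed_algebra"
  shows "Ck k f \<Longrightarrow> Ck k g \<Longrightarrow> Ck k (\<lambda>x. f x * g x)"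
proof (induction k arbitrary: f g)
  case 0
  then show ?case by (auto intro: continuous_intros)
next
  case (Suc k)
  from Suc.prems obtain f' g' where d:
    "\<And>x. (f has_derivative f' x) (at x)" "\<And>u. Ck k (\<lambda>x. f' x u)"
    "\<And>x. (g has_derivative g' x) (at x)" "\<And>u. Ck k (\<lambda>x. g' x u)" by auto
  have "Ck k f" "Ck k g" using Suc.prems Ck_Suc_imp_Ck by blast+
  then show ?case unfolding Ck.simps
    by (intro exI[of _ "\<lambda>x u. f x * g' x u + f' x u * g x"]) (auto intro!: has_derivative_mult Ck_add d Suc.IH)
qed

lemma Ck_inverse:
  fixes f :: "'a::euclidean_space \<Rightarrow> 'b::real_normed_field"
  assumes "\<And>x. f x \<noteq> 0"
  shows "Ck k f \<Longrightarrow> Ck k (\<lambda>x. inverse (f x))"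
proof (induction k)
  case 0
  then show ?case using assms by (auto intro: continuous_intros)
next
  case (Suc k)
  from Suc.prems obtain f' where d:
    "\<And>x. (f has_derivative f' x) (at x)" "\<And>u. Ck k (\<lambda>x. f' x u)" by auto
  have IH: "Ck k (\<lambda>x. inverse (f x))" using Suc Ck_Suc_imp_Ck by blast
  show ?case unfolding Ck.simps
  proof (intro exI[of _ "\<lambda>x u. (-1) * (inverse (f x) * f' x u * inverse (f x))"] conjI allI)
    fix x show "((\<lambda>x. inverse (f x)) has_derivative (\<lambda>u. (-1) * (inverse (f x) * f' x u * inverse (f x)))) (at x)"
      using Deriv.has_derivative_inverse[OF assms d(1)] by simp
  next
    fix u show "Ck k (\<lambda>x. (-1) * (inverse (f x) * f' x u * inverse (f x)))"
      by (intro Ck_mult IH d Ck_const)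
  qed
qed

text \<open>A directional derivative of this function is a constant multiple of the function itself.  Every
  time-dependent ingredient of the explicit solution, \<open>cos\<close> and \<open>sin\<close> included, is a linear combination of such exponentials.\<close>

lemma Ck_cis: "Ck k (\<lambda>x::real \<times> real. cis (\<alpha> * fst x + \<beta> * snd x))"
proof (induction k)
  case 0
  then show ?case by (auto intro!: continuous_intros)
next
  case (Suc k)
  have "((\<lambda>x::real \<times> real. cis (\<alpha> * fst x + \<beta> * snd x)) has_derivative
      (\<lambda>u. (\<i> * of_real (\<alpha> * fst u + \<beta> * snd u)) * cis (\<alpha> * fst x + \<beta> * snd x))) (at x)" for x
  proof -
    have "((\<lambda>x::real \<times> real. \<i> * of_real (\<alpha> * fst x + \<beta> * snd x)) has_derivative
        (\<lambda>u. \<i> * of_real (\<alpha> * fst u + \<beta> * snd u))) (at x)"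
      by (auto intro!: derivative_eq_intros)
    from has_derivative_compose[OF this has_field_derivative_imp_has_derivative[OF DERIV_exp]]
    show ?thesis by (simp add: cis_conv_exp mult.commute)
  qed
  then show ?case unfolding Ck.simps
    by (intro exI[of _ "\<lambda>x u. (\<i> * of_real (\<alpha> * fst u + \<beta> * snd u)) * cis (\<alpha> * fst x + \<beta> * snd x)"])
      (auto intro!: Ck_mult Ck_const Suc.IH)
qed

section \<open>An explicit solution on the degree-one rational functions\<close>

text \<open>With \<open>b\<close> the shift and \<open>p\<close> the pole parameter, put \<open>f = (w + b) / (1 - p w)\<close>.  For real
  parameters with \<open>(4 + e\<^sup>2) s\<^sup>2 + C\<^sup>2 = 1\<close>, the function below is the numerator of the projection of \<open>\<bar>f\<bar>\<^sup>2 f\<close>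
  over the denominator \<open>(1 - p w)\<^sup>2\<close>.  It is written in the form
  in which it arises from the time derivative of the solution: the four summands come from the phase, from
  the rotation of \<open>w\<close>, and from the derivatives of \<open>b\<close> and \<open>p\<close>.\<close>

definition projected_cubic :: "complex \<Rightarrow> complex \<Rightarrow> complex \<Rightarrow> complex \<Rightarrow> complex" where
  "projected_cubic e C s w =
     (let b = e * C - \<i> * (2 + e\<^sup>2) * s; p = - 2 * \<i> * s in
       (1 + e\<^sup>2/2) * (w + b) * (1 - p * w) + e\<^sup>2/2 * w * (1 + p * b)
       + \<i> * (- (e\<^sup>2 * (4 + e\<^sup>2) * s / 2) - \<i> * (2 + e\<^sup>2) * e * C / 2) * (1 - p * w)
       + \<i> * (w + b) * (- \<i> * e * C) * w)"

text \<open>For real parameters and \<open>\<bar>w\<bar> = 1\<close>, the right-hand side divided by \<open>(1 - p w)\<^sup>2 (w - 2 \<i> s)\<close> is \<open>\<bar>f\<bar>\<^sup>2 f\<close> minus the polar part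
  \<open>e\<^sup>2 / (w - 2 \<i> s)\<close> at the point \<open>2 \<i> s = cnj p\<close> of the disc.  The residue is the constant \<open>e\<^sup>2\<close>
  because \<open>cnj p + b = e (C - \<i> e s)\<close>, while by the assumed conservation law \<open>1 + b' cnj p = (C + \<i> e s)\<^sup>2\<close>
  and \<open>1 - \<bar>p\<bar>\<^sup>2 = C\<^sup>2 + e\<^sup>2 s\<^sup>2\<close>.\<close>

lemma projected_cubic_identity:
  fixes e C s w :: complex
  assumes "(4 + e\<^sup>2) * s\<^sup>2 + C\<^sup>2 = 1"
  defines "b \<equiv> e * C - \<i> * (2 + e\<^sup>2) * s" and "b' \<equiv> e * C + \<i> * (2 + e\<^sup>2) * s"
  defines "p \<equiv> - 2 * \<i> * s"
  shows "(w - 2 * \<i> * s) * projected_cubic e C s w = (w + b)\<^sup>2 * (1 + b' * w) - e\<^sup>2 * (1 - p * w)\<^sup>2"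
proof -
  define Q where "Q = 2 * projected_cubic e C s w"
  have Q: "Q = (2 + e\<^sup>2) * (w + b) * (1 - p * w) + e\<^sup>2 * w * (1 + p * b)
     + \<i> * (- (e\<^sup>2 * (4 + e\<^sup>2) * s) - \<i> * (2 + e\<^sup>2) * e * C) * (1 - p * w)
     + 2 * \<i> * (w + b) * (- \<i> * e * C) * w"
    unfolding Q_def projected_cubic_def Let_def b_def p_def by (simp add: field_simps)
  have "\<i>\<^sup>2 = -1" by simp
  then have "(w - 2 * \<i> * s) * Q = 2 * ((w + b)\<^sup>2 * (1 + b' * w) - e\<^sup>2 * (1 - p * w)\<^sup>2)"
    using assms(1) unfolding Q b_def b'_def p_def by algebra
  then have "2 * ((w - 2 * \<i> * s) * projected_cubic e C s w)
      = 2 * ((w + b)\<^sup>2 * (1 + b' * w) - e\<^sup>2 * (1 - p * w)\<^sup>2)"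
    unfolding Q_def by (simp only: mult.left_commute)
  then show ?thesis by (simp only: mult_cancel_left) simp
qed

text \<open>The two modes solve \<open>C' = - e (4 + e\<^sup>2) s / 2\<close>, \<open>s' = e C / 2\<close> with \<open>C = 1\<close>, \<open>s = 0\<close> at time zero.  Dividing
  the sine by \<open>sqrt (4 + e\<^sup>2)\<close> keeps the square root out of all algebraic identities.\<close>

definition cos_mode :: "real \<Rightarrow> real \<Rightarrow> real" where
  "cos_mode e \<tau> = cos (e * sqrt (4 + e\<^sup>2) / 2 * \<tau>)"

definition sin_mode :: "real \<Rightarrow> real \<Rightarrow> real" where
  "sin_mode e \<tau> = sin (e * sqrt (4 + e\<^sup>2) / 2 * \<tau>) / sqrt (4 + e\<^sup>2)"

definition orbit_shift :: "real \<Rightarrow> real \<Rightarrow> complex" where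
  "orbit_shift e \<tau> = of_real e * of_real (cos_mode e \<tau>) - \<i> * (2 + (of_real e)\<^sup>2) * sin_mode e \<tau>"

definition orbit_pole :: "real \<Rightarrow> real \<Rightarrow> complex" where
  "orbit_pole e \<tau> = - 2 * \<i> * sin_mode e \<tau>"

text \<open>The solution with initial datum \<open>z + e\<close>, found by Gerard and Grellier.  The rotation of the
  variable and the global phase are split off, so that the remaining shift and pole depend on time only
  through the two modes.\<close>

definition szego_orbit :: "real \<Rightarrow> real \<Rightarrow> complex \<Rightarrow> complex" where
  "szego_orbit e \<tau> z =
     (let w = cis (- (e\<^sup>2/2) * \<tau>) * z in
       cis (- (1 + e\<^sup>2/2) * \<tau>) * (w + orbit_shift e \<tau>) / (1 - orbit_pole e \<tau> * w))"

lemma sqrt_four_plus_pos: "sqrt (4 + e\<^sup>2) > 0" and sqrt_four_plus_square: "(sqrt (4 + e\<^sup>2))\<^sup>2 = 4 + e\<^sup>2" for e :: real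
  by (auto simp: add_pos_nonneg)

lemma mode_identity: "(4 + e\<^sup>2) * (sin_mode e \<tau>)\<^sup>2 + (cos_mode e \<tau>)\<^sup>2 = 1"
  using sqrt_four_plus_pos[of e] by (simp add: sin_mode_def cos_mode_def power_divide add_pos_nonneg
      less_imp_neq[THEN not_sym])

text \<open>The pole \<open>1 / p\<close> stays outside the closed disc for all times, although it comes within distance of
  order \<open>e\<^sup>2\<close> of it as \<open>e \<rightarrow> 0\<close>: \<open>\<bar>p\<bar>\<close> oscillates between \<open>0\<close> and \<open>2 / sqrt (4 + e\<^sup>2)\<close>.\<close>

lemma cmod_orbit_pole:
  assumes "e \<noteq> 0" shows "cmod (orbit_pole e \<tau>) < 1"
proof -
  have "2 = sqrt 4" by simp
  also have "\<dots> < sqrt (4 + e\<^sup>2)" using assms by (intro real_sqrt_less_mono) simp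
  finally have "2 < sqrt (4 + e\<^sup>2)" .
  then have "2 * \<bar>sin x\<bar> < sqrt (4 + e\<^sup>2)" for x
    using abs_sin_le_one[of x] by linarith
  then have "2 * \<bar>sin_mode e \<tau>\<bar> < 1"
    using sqrt_four_plus_pos[of e] by (simp add: sin_mode_def abs_divide divide_less_eq)
  then show ?thesis by (simp add: orbit_pole_def norm_mult)
qed

lemma has_derivative_cos_mode:
  "(cos_mode e has_real_derivative - (e * (4 + e\<^sup>2) / 2) * sin_mode e \<tau>) (at \<tau>)"
proof -
  define r where "r = sqrt (4 + e\<^sup>2)"
  have r: "r > 0" "4 + e\<^sup>2 = r * r"
    using sqrt_four_plus_pos[of e] sqrt_four_plus_square[of e] by (simp_all add: r_def power2_eq_square)
  have "((\<lambda>\<tau>. cos (e * r / 2 * \<tau>)) has_real_derivative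
      - (e * (r * r) / 2) * (sin (e * r / 2 * \<tau>) / r)) (at \<tau>)"
    using r(1) by (auto intro!: derivative_eq_intros)
  then show ?thesis
    unfolding cos_mode_def sin_mode_def r_def[symmetric] by (simp add: r(2))
qed

lemma has_derivative_sin_mode:
  "(sin_mode e has_real_derivative e / 2 * cos_mode e \<tau>) (at \<tau>)"
proof -
  define r where "r = sqrt (4 + e\<^sup>2)"
  have r: "r > 0" using sqrt_four_plus_pos[of e] by (simp add: r_def)
  then show ?thesis
    unfolding cos_mode_def sin_mode_def r_def[symmetric]
    by (auto intro!: derivative_eq_intros)
qed

lemma has_derivative_cis:
  "((\<lambda>\<tau>. cis (\<alpha> * \<tau>)) has_vector_derivative \<i> * of_real \<alpha> * cis (\<alpha> * \<tau>)) (at \<tau>)"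
  unfolding cis_conv_exp
  by (auto intro!: derivative_eq_intros has_vector_derivative_real_field)

text \<open>The left-hand side is the form in which the product rule delivers the derivative of \<open>E n d\<^sup>-\<^sup>1\<close> when
  \<open>E' = - \<i> k E\<close>.\<close>

lemma quotient_rule_identity:
  fixes E n n' d d' k :: complex
  assumes "d \<noteq> 0"
  shows "E * n * - (inverse d * d' * inverse d) + (E * n' + - \<i> * k * E * n) * inverse d
      = - \<i> * (E * (k * n * d + \<i> * n' * d - \<i> * n * d') / d\<^sup>2)"
  using assms by (simp add: divide_simps) (simp add: algebra_simps power2_eq_square)

text \<open>The time derivative is \<open>- \<i>\<close> times the analytic part of the cubic term, which is identified in
  \<open>szego_orbit_cubic\<close>.\<close>

lemma szego_orbit_has_derivative:
  fixes \<tau> :: real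
  assumes e: "e \<noteq> 0" and z: "cmod z = 1"
  defines "w \<equiv> cis (- (e\<^sup>2/2) * \<tau>) * z"
  shows "((\<lambda>\<tau>. szego_orbit e \<tau> z) has_vector_derivative
    - \<i> * (cis (- (1 + e\<^sup>2/2) * \<tau>) * projected_cubic e (cos_mode e \<tau>) (sin_mode e \<tau>) w
       / (1 - orbit_pole e \<tau> * w)\<^sup>2)) (at \<tau>)"
proof -
  have w: "cmod w = 1" by (simp add: w_def norm_mult z)
  have den: "1 - orbit_pole e \<tau> * w \<noteq> 0" by (rule one_minus_mult_nonzero[OF cmod_orbit_pole[OF e] w])
  define E where "E = cis (- (1 + e\<^sup>2/2) * \<tau>)"
  define C where "C = complex_of_real (cos_mode e \<tau>)"
  define s where "s = complex_of_real (sin_mode e \<tau>)"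
  define c where "c = complex_of_real e"
  define db where "db = c * (- (c * (4 + c\<^sup>2) / 2) * s) - \<i> * (2 + c\<^sup>2) * (c / 2 * C)"
  define dp where "dp = - 2 * \<i> * (c / 2 * C)"
  have b: "(orbit_shift e has_vector_derivative db) (at \<tau>)"
    unfolding orbit_shift_def
    by (rule has_vector_derivative_eq_rhs, (rule derivative_intros has_derivative_cos_mode has_derivative_sin_mode)+)
      (simp add: db_def s_def C_def c_def)
  have p: "(orbit_pole e has_vector_derivative dp) (at \<tau>)"
    unfolding orbit_pole_def
    by (rule has_vector_derivative_eq_rhs, (rule derivative_intros has_derivative_sin_mode)+)
      (simp add: dp_def C_def c_def)
  define Ef where "Ef = (\<lambda>\<tau>. cis (- (1 + e\<^sup>2/2) * \<tau>))"
  define wf where "wf = (\<lambda>\<tau>. cis (- (e\<^sup>2/2) * \<tau>) * z)"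
  define nf where "nf = (\<lambda>\<tau>. wf \<tau> + orbit_shift e \<tau>)"
  define df where "df = (\<lambda>\<tau>. 1 - orbit_pole e \<tau> * wf \<tau>)"
  define k where "k = 1 + c\<^sup>2/2"
  define n' where "n' = - \<i> * (c\<^sup>2/2) * w + db"
  define d' where "d' = - (orbit_pole e \<tau> * (- \<i> * (c\<^sup>2/2) * w) + dp * w)"
  have w_eq: "wf \<tau> = w" by (simp add: wf_def w_def)
  have w': "(wf has_vector_derivative - \<i> * (c\<^sup>2/2) * w) (at \<tau>)"
    unfolding wf_def
    by (rule has_vector_derivative_eq_rhs, (rule derivative_intros has_derivative_cis)+)
      (simp add: w_def c_def)
  have E': "(Ef has_vector_derivative - \<i> * k * Ef \<tau>) (at \<tau>)"
    unfolding Ef_def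
    by (rule has_vector_derivative_eq_rhs, (rule derivative_intros has_derivative_cis)+)
      (simp add: k_def c_def algebra_simps)
  have num: "(nf has_vector_derivative n') (at \<tau>)"
    unfolding n'_def nf_def by (intro has_vector_derivative_add w' b)
  have denom: "(df has_vector_derivative d') (at \<tau>)"
    unfolding df_def
    by (rule has_vector_derivative_eq_rhs, rule has_vector_derivative_diff[OF has_vector_derivative_const],
        rule has_vector_derivative_mult[OF p w']) (simp add: d'_def w_eq)
  have d0: "df \<tau> \<noteq> 0" using den by (simp add: df_def w_eq)
  have inv: "((\<lambda>\<tau>. inverse (df \<tau>)) has_vector_derivative - (inverse (df \<tau>) * d' * inverse (df \<tau>))) (at \<tau>)"
    using Deriv.has_derivative_inverse[OF d0 denom[unfolded has_vector_derivative_def]]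
    by (simp add: has_vector_derivative_def)
  have Q: "projected_cubic c C s w = k * nf \<tau> * df \<tau> + \<i> * n' * df \<tau> - \<i> * nf \<tau> * d'"
  proof -
    have "2 * projected_cubic c C s w = 2 * (k * nf \<tau> * df \<tau> + \<i> * n' * df \<tau> - \<i> * nf \<tau> * d')"
      unfolding projected_cubic_def Let_def n'_def d'_def nf_def df_def w_eq k_def db_def dp_def
        orbit_shift_def orbit_pole_def c_def[symmetric] C_def[symmetric] s_def[symmetric]
      by (simp add: field_simps power2_eq_square)
    then show ?thesis by (simp only: mult_cancel_left) simp
  qed
  have "((\<lambda>\<tau>. Ef \<tau> * nf \<tau> * inverse (df \<tau>)) has_vector_derivative
      - \<i> * (Ef \<tau> * projected_cubic c C s w / (df \<tau>)\<^sup>2)) (at \<tau>)"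
    unfolding Q quotient_rule_identity[OF d0, symmetric]
    by (intro has_vector_derivative_mult E' num inv)
  moreover have "(\<lambda>\<tau>. Ef \<tau> * nf \<tau> * inverse (df \<tau>)) = (\<lambda>\<tau>. szego_orbit e \<tau> z)"
    by (simp add: Ef_def nf_def df_def wf_def szego_orbit_def Let_def divide_inverse[symmetric])
  ultimately show ?thesis
    by (simp add: Ef_def df_def w_eq c_def C_def s_def)
qed

text \<open>Conjugation on the circle is inversion, so the cubic term is a rational function of \<open>w\<close> with a double
  pole outside the disc and a simple one inside.  The identity for \<open>projected_cubic\<close> is its partial
  fraction decomposition; the simple pole contributes the coanalytic summand.\<close>

lemma szego_orbit_cubic:
  fixes \<tau> :: real
  assumes e: "e \<noteq> 0" and z: "cmod z = 1"
  defines "w \<equiv> cis (- (e\<^sup>2/2) * \<tau>) * z" and "E \<equiv> cis (- (1 + e\<^sup>2/2) * \<tau>)"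
  shows "of_real ((cmod (szego_orbit e \<tau> z))\<^sup>2) * szego_orbit e \<tau> z
    = E * projected_cubic e (cos_mode e \<tau>) (sin_mode e \<tau>) w / (1 - orbit_pole e \<tau> * w)\<^sup>2
      + E * (of_real e)\<^sup>2 * cnj (w / (1 - orbit_pole e \<tau> * w))"
proof -
  define C where "C = complex_of_real (cos_mode e \<tau>)"
  define s where "s = complex_of_real (sin_mode e \<tau>)"
  define c where "c = complex_of_real e"
  define p where "p = orbit_pole e \<tau>"
  define n where "n = w + orbit_shift e \<tau>"
  define b' where "b' = c * C + \<i> * (2 + c\<^sup>2) * s"
  have w: "cmod w = 1" and E: "cmod E = 1" by (simp_all add: w_def E_def norm_mult z)
  then have w0: "w \<noteq> 0" and wc: "cnj w = inverse w" and Ec: "E * cnj E = 1"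
    using complex_norm_square[of E] by (auto simp: cnj_eq_inverse_circle)
  have d: "1 - p * w \<noteq> 0"
    unfolding p_def by (rule one_minus_mult_nonzero[OF cmod_orbit_pole[OF e] w])
  have p_eq: "p = - 2 * \<i> * s" by (simp add: p_def orbit_pole_def s_def)
  have cd: "cnj (1 - p * w) = (w - 2 * \<i> * s) / w"
    using w0 by (simp add: p_eq s_def wc field_simps)
  then have wp: "w - 2 * \<i> * s \<noteq> 0" using d by (metis complex_cnj_zero_iff divide_eq_0_iff)
  have u: "szego_orbit e \<tau> z = E * n / (1 - p * w)"
    by (simp add: szego_orbit_def w_def E_def n_def p_def Let_def)
  have cn: "cnj n = (1 + b' * w) / w"
    using w0 by (simp add: n_def orbit_shift_def b'_def c_def C_def s_def wc field_simps)
  have "complex_of_real ((4 + e\<^sup>2) * (sin_mode e \<tau>)\<^sup>2 + (cos_mode e \<tau>)\<^sup>2) = 1"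
    by (simp only: mode_identity of_real_1)
  then have "(4 + c\<^sup>2) * s\<^sup>2 + C\<^sup>2 = 1" by (simp add: c_def C_def s_def)
  from projected_cubic_identity[OF this, of w]
  have id: "(w - 2 * \<i> * s) * projected_cubic c C s w = n\<^sup>2 * (1 + b' * w) - c\<^sup>2 * (1 - p * w)\<^sup>2"
    by (simp add: n_def b'_def p_eq orbit_shift_def c_def C_def s_def)
  have "of_real ((cmod (szego_orbit e \<tau> z))\<^sup>2) * szego_orbit e \<tau> z
     = (E * cnj E) * E * (n\<^sup>2 * cnj n / ((1 - p * w)\<^sup>2 * cnj (1 - p * w)))"
    unfolding complex_norm_square u by (simp add: power2_eq_square mult_ac)
  also have "\<dots> = E * (n\<^sup>2 * (1 + b' * w) / ((1 - p * w)\<^sup>2 * (w - 2 * \<i> * s)))"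
    unfolding Ec cn cd using w0 by simp
  also have "n\<^sup>2 * (1 + b' * w) = (w - 2 * \<i> * s) * projected_cubic c C s w + c\<^sup>2 * (1 - p * w)\<^sup>2"
    by (simp add: id)
  also have "E * (((w - 2 * \<i> * s) * projected_cubic c C s w + c\<^sup>2 * (1 - p * w)\<^sup>2) / ((1 - p * w)\<^sup>2 * (w - 2 * \<i> * s)))
     = E * projected_cubic c C s w / (1 - p * w)\<^sup>2 + E * c\<^sup>2 * (1 / (w - 2 * \<i> * s))"
    using d wp by (simp add: add_divide_distrib distrib_left)
  also have "1 / (w - 2 * \<i> * s) = cnj (w / (1 - p * w))"
    unfolding complex_cnj_divide cd wc using w0 by simp
  finally show ?thesis by (simp add: p_def c_def C_def s_def)
qed

section \<open>Rescaled solutions\<close>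

text \<open>Both changes of variable are symmetries of the equation: \<open>v(t,z) \<mapsto> l v(l\<^sup>2 t, z)\<close> because the nonlinearity
  is cubic, and \<open>z \<mapsto> z\<^sup>N\<close> because it commutes with multiplication, conjugation and the projection.  The first
  accelerates the growth of the mean, the second makes the nonconstant part of the datum small in a
  negative Sobolev norm without changing the mean.\<close>

definition rescaled_orbit :: "real \<Rightarrow> real \<Rightarrow> nat \<Rightarrow> real \<Rightarrow> complex \<Rightarrow> complex" where
  "rescaled_orbit e l N t z = of_real l * szego_orbit e (l\<^sup>2 * t) (z ^ N)"

lemma rescaled_orbit_eq:
  "rescaled_orbit e l N t z =
     of_real l * (cis (- (1 + e\<^sup>2/2) * (l\<^sup>2 * t)) *
       (cis (- (e\<^sup>2/2) * (l\<^sup>2 * t)) * z ^ N + orbit_shift e (l\<^sup>2 * t))) /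
     (1 - orbit_pole e (l\<^sup>2 * t) * cis (- (e\<^sup>2/2) * (l\<^sup>2 * t)) * z ^ N)"
  by (simp add: rescaled_orbit_def szego_orbit_def Let_def mult.assoc)

lemma cmod_rotated_pole:
  "e \<noteq> 0 \<Longrightarrow> cmod (orbit_pole e \<tau> * cis \<alpha>) < 1"
  by (simp add: norm_mult cmod_orbit_pole)

lemma rescaled_orbit_denominator:
  assumes "e \<noteq> 0" "cmod z = 1"
  shows "1 - orbit_pole e \<tau> * cis \<alpha> * z ^ N \<noteq> 0"
  by (intro one_minus_mult_nonzero cmod_rotated_pole assms) (simp add: norm_power assms)

lemma rational_rescaled_orbit:
  assumes "e \<noteq> 0" shows "rational_on_circle (rescaled_orbit e l N t)"
proof -
  define \<tau> where "\<tau> = l\<^sup>2 * t"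
  define E where "E = cis (- (1 + e\<^sup>2/2) * \<tau>)"
  define r where "r = cis (- (e\<^sup>2/2) * \<tau>)"
  define p where "p = monom (of_real l * E * r) N + [:of_real l * E * orbit_shift e \<tau>:]"
  define q where "q = [:1:] - monom (orbit_pole e \<tau> * r) N"
  have "poly q z \<noteq> 0 \<and> rescaled_orbit e l N t z = poly p z / poly q z" if "cmod z = 1" for z
    using rescaled_orbit_denominator[OF assms that, of \<tau> "- (e\<^sup>2/2) * \<tau>" N]
    unfolding rescaled_orbit_eq \<tau>_def[symmetric] E_def[symmetric] r_def[symmetric]
    by (simp add: p_def q_def poly_monom algebra_simps)
  then show ?thesis
    unfolding rational_on_circle_def by (intro exI[of _ p] exI[of _ q] ballI) simp
qed

lemma hardy_H2_rescaled_orbit: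
  assumes "e \<noteq> 0" shows "rescaled_orbit e l N t \<in> hardy_H2"
proof -
  define \<tau> where "\<tau> = l\<^sup>2 * t"
  define E where "E = cis (- (1 + e\<^sup>2/2) * \<tau>)"
  define r where "r = cis (- (e\<^sup>2/2) * \<tau>)"
  have "(\<lambda>z. of_real l * (E * (r * z ^ N + orbit_shift e \<tau>)) / (1 - orbit_pole e \<tau> * r * z ^ N)) \<in> hardy_H2"
    unfolding r_def
    by (intro hardy_H2_divide hardy_H2_cmult hardy_H2_add hardy_H2_power hardy_H2_const
        cmod_rotated_pole assms)
  then show ?thesis
    unfolding rescaled_orbit_eq[abs_def] \<tau>_def E_def r_def .
qed

text \<open>Up to phases, \<open>(w + b) / (1 - p w) = b + (1 + b p) w / (1 - p w)\<close>, and the last summand is an element of \<open>H\<^sup>2\<close>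
  multiplied by a positive power of \<open>z\<close>.\<close>

lemma mean_rescaled_orbit:
  assumes "e \<noteq> 0" "N > 0"
  shows "cmod (circle_inner (rescaled_orbit e l N t) (\<lambda>_. 1)) = \<bar>l\<bar> * cmod (orbit_shift e (l\<^sup>2 * t))"
proof -
  define \<tau> where "\<tau> = l\<^sup>2 * t"
  define E where "E = cis (- (1 + e\<^sup>2/2) * \<tau>)"
  define r where "r = cis (- (e\<^sup>2/2) * \<tau>)"
  define b where "b = orbit_shift e \<tau>"
  define p where "p = orbit_pole e \<tau> * r"
  define h where "h = (\<lambda>z. 1 / (1 - p * z ^ N))"
  have h: "h \<in> hardy_H2"
    unfolding h_def p_def r_def
    by (intro hardy_H2_divide hardy_H2_const cmod_rotated_pole assms)
  have L2: "(\<lambda>z. (r + b * p) * (h z * z ^ N)) \<in> circle_L2" "(\<lambda>_. b) \<in> circle_L2"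
    using circle_L2_mult_continuous[of h "\<lambda>z. (r + b * p) * z ^ N"] h hardy_H2_const[of b]
    by (simp_all add: hardy_H2_def continuous_intros mult.left_commute)
  have "circle_inner (rescaled_orbit e l N t) (\<lambda>_. 1) = fourier_coeff (rescaled_orbit e l N t) 0"
    by (simp add: fourier_coeff_def)
  also have "\<dots> = fourier_coeff (\<lambda>z. of_real l * E * (b + (r + b * p) * (h z * z ^ N))) 0"
  proof (rule fourier_coeff_cong)
    fix z :: complex assume z: "cmod z = 1"
    have d: "1 - p * z ^ N \<noteq> 0"
      using rescaled_orbit_denominator[OF assms(1) z] by (simp add: p_def r_def)
    have "r * z ^ N + b = b * (1 - p * z ^ N) + (r + b * p) * z ^ N" by (simp add: algebra_simps)
    then have "(r * z ^ N + b) / (1 - p * z ^ N) = b + (r + b * p) * (h z * z ^ N)"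
      using d by (simp add: h_def add_divide_distrib)
    then show "rescaled_orbit e l N t z = of_real l * E * (b + (r + b * p) * (h z * z ^ N))"
      unfolding rescaled_orbit_eq \<tau>_def[symmetric] E_def[symmetric] r_def[symmetric] b_def[symmetric] p_def[symmetric]
      by (metis mult.assoc times_divide_eq_right)
  qed
  also have "\<dots> = of_real l * E * (fourier_coeff (\<lambda>_. b) 0 + (r + b * p) * fourier_coeff h (- int N))"
    by (simp only: fourier_coeff_cmult fourier_coeff_add[OF L2(2,1)] fourier_coeff_shift) simp
  also have "fourier_coeff h (- int N) = 0" using h assms(2) by (simp add: hardy_H2_def)
  also have "fourier_coeff (\<lambda>_. b) 0 = b"
    using fourier_coeff_cmult[of b "\<lambda>z. z ^ 0" 0] fourier_coeff_power[of 0 0] by simp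
  finally show ?thesis by (simp add: norm_mult E_def b_def \<tau>_def)
qed

text \<open>Only the degree matters: a polynomial in \<open>z\<^sup>N\<close> over \<open>(1 - p z\<^sup>N)\<^sup>2\<close> lies in \<open>H\<^sup>2\<close>.\<close>

lemma projected_cubic_quadratic:
  obtains a0 a1 a2 where "\<And>w. projected_cubic e C s w = a0 + a1 * w + a2 * w\<^sup>2"
proof -
  define b where "b = e * C - \<i> * (2 + e\<^sup>2) * s"
  define p where "p = - 2 * \<i> * s"
  define d where "d = \<i> * (- (e\<^sup>2 * (4 + e\<^sup>2) * s / 2) - \<i> * (2 + e\<^sup>2) * e * C / 2)"
  define k where "k = 1 + e\<^sup>2/2"
  have "projected_cubic e C s w = k * (w + b) * (1 - p * w) + e\<^sup>2/2 * w * (1 + p * b)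
      + d * (1 - p * w) + \<i> * (w + b) * (- \<i> * e * C) * w" for w
    by (simp add: projected_cubic_def Let_def b_def p_def d_def k_def)
  also have "\<dots> w = (k * b + d) + (k - k * b * p + e\<^sup>2/2 * (1 + p * b) - d * p + b * e * C) * w
      + (e * C - k * p) * w\<^sup>2" for w
    by (simp add: algebra_simps power2_eq_square)
  finally show thesis by (rule that)
qed

lemma szego_projection_rescaled_orbit:
  fixes e l t :: real
  assumes e: "e \<noteq> 0" and N: "N > 0"
  defines "E \<equiv> cis (- (1 + e\<^sup>2/2) * (l\<^sup>2 * t))" and "r \<equiv> cis (- (e\<^sup>2/2) * (l\<^sup>2 * t))"
  shows "szego_projection (\<lambda>z. of_real ((cmod (rescaled_orbit e l N t z))\<^sup>2) * rescaled_orbit e l N t z)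
    (\<lambda>z. of_real l ^ 3 * (E * projected_cubic e (cos_mode e (l\<^sup>2 * t)) (sin_mode e (l\<^sup>2 * t)) (r * z ^ N)
       / (1 - orbit_pole e (l\<^sup>2 * t) * (r * z ^ N))\<^sup>2))"
    (is "szego_projection ?F ?G")
proof -
  define \<tau> where "\<tau> = l\<^sup>2 * t"
  define p where "p = orbit_pole e \<tau> * r"
  have p: "cmod p < 1" unfolding p_def r_def by (rule cmod_rotated_pole[OF e])
  obtain a0 a1 a2 where a:
    "\<And>w. projected_cubic e (cos_mode e \<tau>) (sin_mode e \<tau>) w = a0 + a1 * w + a2 * w\<^sup>2"
    using projected_cubic_quadratic by blast
  have G: "?G \<in> hardy_H2"
  proof -
    have "(\<lambda>z. (of_real l ^ 3 * E * (a0 + a1 * r * z ^ N + a2 * r\<^sup>2 * z ^ (N * 2))) / (1 - p * z ^ N) / (1 - p * z ^ N))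
        \<in> hardy_H2"
      by (intro hardy_H2_divide hardy_H2_cmult hardy_H2_add hardy_H2_power hardy_H2_const p)
    also have "(\<lambda>z. (of_real l ^ 3 * E * (a0 + a1 * r * z ^ N + a2 * r\<^sup>2 * z ^ (N * 2))) / (1 - p * z ^ N) / (1 - p * z ^ N)) = ?G"
      unfolding \<tau>_def[symmetric] a
      by (simp add: p_def power2_eq_square power_mult mult_ac)
    finally show ?thesis .
  qed
  have diff: "?F z - ?G z = (of_real l ^ 3 * E * (of_real e)\<^sup>2 * cnj r) * cnj (z ^ N / (1 - p * z ^ N))"
    if "cmod z = 1" for z
  proof -
    have "cmod (z ^ N) = 1" using that by (simp add: norm_power)
    note cubic = szego_orbit_cubic[OF e this, of \<tau>, unfolded \<tau>_def, folded E_def r_def]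
    \<comment> \<open>Homogeneity of degree three turns the amplitude \<open>l\<close> into \<open>l\<^sup>3\<close>.\<close>
    have "?F z = of_real l ^ 3 * (of_real ((cmod (szego_orbit e (l\<^sup>2 * t) (z ^ N)))\<^sup>2) * szego_orbit e (l\<^sup>2 * t) (z ^ N))"
      by (simp add: rescaled_orbit_def norm_mult power_mult_distrib power2_eq_square power3_eq_cube flip: of_real_mult)
    then show ?thesis unfolding cubic
      by (simp add: p_def \<tau>_def distrib_left mult_ac)
  qed
  have "continuous_on (sphere 0 1) (rescaled_orbit e l N t)"
    unfolding rescaled_orbit_eq[abs_def]
    by (intro continuous_intros ballI rescaled_orbit_denominator e) simp
  then have F: "?F \<in> circle_L2"
    by (intro circle_L2_continuous continuous_intros)
  have "circle_inner (\<lambda>z. ?F z - ?G z) h = 0" if "h \<in> hardy_H2" for h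
  proof -
    have "circle_inner (\<lambda>z. ?F z - ?G z) h
      = circle_inner (\<lambda>z. (of_real l ^ 3 * E * (of_real e)\<^sup>2 * cnj r) * cnj (z ^ N / (1 - p * z ^ N))) h"
      by (intro circle_inner_eqI) (simp only: diff)
    also have "\<dots> = 0" by (rule circle_inner_coanalytic[OF that p N])
    finally show ?thesis .
  qed
  with F G show ?thesis unfolding szego_projection_def by blast
qed

lemma Ck_rescaled_orbit:
  assumes "e \<noteq> 0"
  shows "Ck k (\<lambda>x::real \<times> real. rescaled_orbit e l N (fst x) (cis (snd x)))"
proof -
  define \<omega> where "\<omega> = e * sqrt (4 + e\<^sup>2) / 2 * l\<^sup>2"
  have time: "Ck k (\<lambda>x::real \<times> real. cis (\<alpha> * fst x))" for \<alpha>
    using Ck_cis[of k \<alpha> 0] by simp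
  have "Ck k (\<lambda>x::real \<times> real. (1/2) * (cis (\<omega> * fst x) + cis (- \<omega> * fst x)))"
    by (intro Ck_mult Ck_add Ck_const time)
  moreover have "(1/2) * (cis (\<omega> * x) + cis (- \<omega> * x)) = of_real (cos_mode e (l\<^sup>2 * x))" for x
    by (simp add: complex_eq_iff cos_mode_def \<omega>_def mult_ac)
  ultimately have C: "Ck k (\<lambda>x::real \<times> real. of_real (cos_mode e (l\<^sup>2 * fst x)) :: complex)" by simp
  have "Ck k (\<lambda>x::real \<times> real. (- \<i> / (2 * of_real (sqrt (4 + e\<^sup>2)))) * (cis (\<omega> * fst x) + (-1) * cis (- \<omega> * fst x)))"
    by (intro Ck_mult Ck_add Ck_const time)
  moreover have "(- \<i> / (2 * of_real (sqrt (4 + e\<^sup>2)))) * (cis (\<omega> * x) + (-1) * cis (- \<omega> * x))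
      = of_real (sin_mode e (l\<^sup>2 * x))" for x
  proof -
    have "cis (\<omega> * x) + (-1) * cis (- \<omega> * x) = 2 * \<i> * of_real (sin (\<omega> * x))"
      by (simp add: complex_eq_iff)
    then show ?thesis by (simp add: sin_mode_def \<omega>_def mult_ac)
  qed
  ultimately have S: "Ck k (\<lambda>x::real \<times> real. of_real (sin_mode e (l\<^sup>2 * fst x)) :: complex)" by simp
  have shift: "Ck k (\<lambda>x::real \<times> real. orbit_shift e (l\<^sup>2 * fst x))"
  proof -
    have "Ck k (\<lambda>x::real \<times> real. of_real e * of_real (cos_mode e (l\<^sup>2 * fst x))
      + (- \<i> * (2 + (of_real e)\<^sup>2)) * of_real (sin_mode e (l\<^sup>2 * fst x)) :: complex)"
      by (intro Ck_mult Ck_add Ck_const C S)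
    then show ?thesis by (simp add: orbit_shift_def)
  qed
  have pole: "Ck k (\<lambda>x::real \<times> real. orbit_pole e (l\<^sup>2 * fst x))"
    unfolding orbit_pole_def by (intro Ck_mult Ck_const S)
  have rot: "Ck k (\<lambda>x::real \<times> real. cis (- (e\<^sup>2/2) * (l\<^sup>2 * fst x)) * cis (snd x) ^ N)"
    using Ck_cis[of k "- (e\<^sup>2/2) * l\<^sup>2" "real N"] by (simp only: Complex.DeMoivre cis_mult mult.assoc)
  have phase: "Ck k (\<lambda>x::real \<times> real. cis (- (1 + e\<^sup>2/2) * (l\<^sup>2 * fst x)))"
    using time[of "- (1 + e\<^sup>2/2) * l\<^sup>2"] by (simp add: mult.assoc)
  have denominator: "Ck k (\<lambda>x::real \<times> real. inverse (1 + (-1) * (orbit_pole e (l\<^sup>2 * fst x) *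
      (cis (- (e\<^sup>2/2) * (l\<^sup>2 * fst x)) * cis (snd x) ^ N))))"
  proof (rule Ck_inverse[OF _ Ck_add[OF Ck_const Ck_mult[OF Ck_const Ck_mult[OF pole rot]]]])
    fix x :: "real \<times> real"
    show "1 + (-1) * (orbit_pole e (l\<^sup>2 * fst x) * (cis (- (e\<^sup>2/2) * (l\<^sup>2 * fst x)) * cis (snd x) ^ N)) \<noteq> 0"
      using rescaled_orbit_denominator[OF assms, of "cis (snd x)" "l\<^sup>2 * fst x" "- (e\<^sup>2/2) * (l\<^sup>2 * fst x)" N]
      by (simp add: mult.assoc)
  qed
  have "Ck k (\<lambda>x::real \<times> real. of_real l * (cis (- (1 + e\<^sup>2/2) * (l\<^sup>2 * fst x)) *
     (cis (- (e\<^sup>2/2) * (l\<^sup>2 * fst x)) * cis (snd x) ^ N + orbit_shift e (l\<^sup>2 * fst x))) *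
     inverse (1 + (-1) * (orbit_pole e (l\<^sup>2 * fst x) * (cis (- (e\<^sup>2/2) * (l\<^sup>2 * fst x)) * cis (snd x) ^ N))))"
    by (rule Ck_mult[OF Ck_mult[OF Ck_const Ck_mult[OF phase Ck_add[OF rot shift]]] denominator])
  moreover have "rescaled_orbit e l N a z = of_real l * (cis (- (1 + e\<^sup>2/2) * (l\<^sup>2 * a)) *
     (cis (- (e\<^sup>2/2) * (l\<^sup>2 * a)) * z ^ N + orbit_shift e (l\<^sup>2 * a))) *
     inverse (1 + (-1) * (orbit_pole e (l\<^sup>2 * a) * (cis (- (e\<^sup>2/2) * (l\<^sup>2 * a)) * z ^ N)))" for a z
    by (simp add: rescaled_orbit_def szego_orbit_def Let_def divide_inverse[symmetric])
  ultimately show ?thesis by (simp only:)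
qed

lemma smooth_szego_solution_rescaled_orbit:
  assumes e: "e \<noteq> 0" and N: "N > 0"
  shows "smooth_szego_solution (rescaled_orbit e l N)"
  unfolding smooth_szego_solution_def
proof (intro conjI allI)
  show "smooth_time_circle (rescaled_orbit e l N)"
    unfolding smooth_time_circle_def case_prod_beta by (intro allI Ck_rescaled_orbit e)
  show "rescaled_orbit e l N t \<in> hardy_H2" for t by (rule hardy_H2_rescaled_orbit[OF e])
  fix t
  define D where "D z = cis (- (1 + e\<^sup>2/2) * (l\<^sup>2 * t)) * projected_cubic e (cos_mode e (l\<^sup>2 * t)) (sin_mode e (l\<^sup>2 * t))
      (cis (- (e\<^sup>2/2) * (l\<^sup>2 * t)) * z ^ N)
      / (1 - orbit_pole e (l\<^sup>2 * t) * (cis (- (e\<^sup>2/2) * (l\<^sup>2 * t)) * z ^ N))\<^sup>2" for z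
  show "\<exists>v'. (\<forall>z\<in>sphere 0 1. ((\<lambda>s. rescaled_orbit e l N s z) has_vector_derivative v' z) (at t)) \<and>
     szego_projection (\<lambda>z. of_real ((cmod (rescaled_orbit e l N t z))\<^sup>2) * rescaled_orbit e l N t z) (\<lambda>z. \<i> * v' z)"
  proof (intro exI[of _ "\<lambda>z. of_real l ^ 3 * (- \<i> * D z)"] conjI ballI)
    fix z :: complex assume "z \<in> sphere 0 1"
    then have "cmod (z ^ N) = 1" by (simp add: norm_power)
    from szego_orbit_has_derivative[OF e this]
    have "((\<lambda>\<tau>. szego_orbit e \<tau> (z ^ N)) has_vector_derivative - \<i> * D z) (at (l\<^sup>2 * t))"
      unfolding D_def .
    moreover have "((\<lambda>s. l\<^sup>2 * s) has_vector_derivative l\<^sup>2) (at t)"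
      by (auto intro!: derivative_eq_intros simp flip: has_real_derivative_iff_has_vector_derivative)
    ultimately have "((\<lambda>s. szego_orbit e (l\<^sup>2 * s) (z ^ N)) has_vector_derivative l\<^sup>2 *\<^sub>R (- \<i> * D z)) (at t)"
      by (rule vector_diff_chain_at[rotated, unfolded o_def])
    from has_vector_derivative_mult_right[OF this, of "of_real l"]
    show "((\<lambda>s. rescaled_orbit e l N s z) has_vector_derivative of_real l ^ 3 * (- \<i> * D z)) (at t)"
      unfolding rescaled_orbit_def[abs_def]
      by (simp add: scaleR_conv_of_real power2_eq_square power3_eq_cube mult.assoc)
  next
    have "\<i> * (a * (- \<i> * b)) = a * b" for a b by (simp add: complex_eq_iff)
    then show "szego_projection (\<lambda>z. of_real ((cmod (rescaled_orbit e l N t z))\<^sup>2) * rescaled_orbit e l N t z)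
        (\<lambda>z. \<i> * (of_real l ^ 3 * (- \<i> * D z)))"
      using szego_projection_rescaled_orbit[OF e N, of l t] unfolding D_def by (simp only:)
  qed
qed

section \<open>Norm inflation\<close>

lemma rescaled_orbit_initial: "rescaled_orbit e l N 0 = (\<lambda>z. of_real l * z ^ N + of_real (l * e))"
  by (simp add: rescaled_orbit_eq fun_eq_iff orbit_pole_def orbit_shift_def sin_mode_def cos_mode_def algebra_simps)

lemma sobolev_norm_binomial:
  assumes "N > 0"
  shows "sobolev_norm s (\<lambda>z. a * z ^ N + b) =
    sqrt ((1 + (real N)\<^sup>2) powr s * (cmod a)\<^sup>2 + (cmod b)\<^sup>2)"
proof -
  have L2: "(\<lambda>z. a * z ^ N) \<in> circle_L2" "(\<lambda>z. b * z ^ 0) \<in> circle_L2"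
    by (intro circle_L2_continuous continuous_intros)+
  have fc: "fourier_coeff (\<lambda>z. a * z ^ N + b) n = (if n = int N then a else 0) + (if n = 0 then b else 0)" for n
    using fourier_coeff_add[OF L2, of n] fourier_coeff_cmult[of b "\<lambda>z. z ^ 0" n] fourier_coeff_power[of 0 n]
    by (simp add: fourier_coeff_cmult fourier_coeff_power)
  have "(\<Sum>\<^sub>\<infinity>n. (1 + (real_of_int n)\<^sup>2) powr s * (cmod (fourier_coeff (\<lambda>z. a * z ^ N + b) n))\<^sup>2)
     = (\<Sum>\<^sub>\<infinity>n\<in>{int N, 0}. (1 + (real_of_int n)\<^sup>2) powr s * (cmod (fourier_coeff (\<lambda>z. a * z ^ N + b) n))\<^sup>2)"
    by (rule infsum_cong_neutral) (auto simp: fc)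
  also have "\<dots> = (1 + (real N)\<^sup>2) powr s * (cmod a)\<^sup>2 + (cmod b)\<^sup>2"
    using assms by (simp add: fc)
  finally show ?thesis by (simp add: sobolev_norm_def)
qed

text \<open>A quarter period after the start the cosine mode vanishes and the shift has modulus
  \<open>(2 + e\<^sup>2) / sqrt (4 + e\<^sup>2)\<close>: however small \<open>e\<close> is, the mean has grown from \<open>e\<close> to at least \<open>1\<close>.\<close>

lemma cmod_orbit_shift_peak:
  assumes "e \<noteq> 0"
  shows "1 \<le> cmod (orbit_shift e (pi / (e * sqrt (4 + e\<^sup>2))))"
proof -
  define r where "r = sqrt (4 + e\<^sup>2)"
  have r: "r > 0" "r\<^sup>2 = 4 + e\<^sup>2" using sqrt_four_plus_pos sqrt_four_plus_square by (simp_all add: r_def)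
  have angle: "e * r / 2 * (pi / (e * r)) = pi / 2" using assms r(1) by simp
  have "orbit_shift e (pi / (e * r)) = - \<i> * of_real ((2 + e\<^sup>2) / r)"
    unfolding orbit_shift_def cos_mode_def sin_mode_def r_def[symmetric] angle by simp
  then have "cmod (orbit_shift e (pi / (e * r))) = (2 + e\<^sup>2) / r"
    using r(1) by (simp only: norm_mult norm_of_real) (simp add: abs_of_nonneg)
  moreover have "r \<le> 2 + e\<^sup>2"
  proof (rule power2_le_imp_le)
    have "(2 + e\<^sup>2)\<^sup>2 = r\<^sup>2 + ((e\<^sup>2)\<^sup>2 + 3 * e\<^sup>2)"
      unfolding r(2) by (simp add: power2_eq_square algebra_simps)
    then show "r\<^sup>2 \<le> (2 + e\<^sup>2)\<^sup>2" by simp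
  qed simp
  ultimately show ?thesis using r(1) by (simp add: r_def)
qed

theorem proposition3p4:
  fixes \<delta> :: real
  assumes "\<delta> > 0"
  shows "\<exists>(v :: real \<Rightarrow> real \<Rightarrow> complex \<Rightarrow> complex) (t :: real \<Rightarrow> real).
     (\<forall>\<epsilon>>0. smooth_szego_solution (v \<epsilon>) \<and> (\<forall>s. rational_on_circle (v \<epsilon> s)) \<and> t \<epsilon> > 0) \<and>
     (t \<longlongrightarrow> 0) (at_right 0) \<and>
     ((\<lambda>\<epsilon>. sobolev_norm (- \<delta>) (v \<epsilon> 0)) \<longlongrightarrow> 0) (at_right 0) \<and>
     filterlim (\<lambda>\<epsilon>. cmod (circle_inner (v \<epsilon> (t \<epsilon>)) (\<lambda>_. 1))) at_top (at_right 0)"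
proof -
  \<comment> \<open>With \<open>e = \<epsilon>\<^sup>4\<close> and \<open>l = \<epsilon>\<^sup>-\<^sup>3\<close>, the initial mean is \<open>l e = \<epsilon>\<close>, the mean at the peak is at least
    \<open>\<epsilon>\<^sup>-\<^sup>3\<close>, and the peak time, of order \<open>1 / (l\<^sup>2 e)\<close>, is of order \<open>\<epsilon>\<^sup>2\<close>.  The frequency is chosen so that
    \<open>N\<^sup>-\<^sup>2\<^sup>\<delta> \<le> \<epsilon>\<^sup>8\<close>, which beats \<open>l\<^sup>2 = \<epsilon>\<^sup>-\<^sup>6\<close>.\<close>
  define N where "N \<epsilon> = nat \<lceil>\<epsilon> powr (- 4 / \<delta>)\<rceil>" for \<epsilon> :: real
  define v where "v \<epsilon> = rescaled_orbit (\<epsilon> ^ 4) (1 / \<epsilon> ^ 3) (N \<epsilon>)" for \<epsilon>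
  define t where "t \<epsilon> = pi * \<epsilon>\<^sup>2 / sqrt (4 + (\<epsilon> ^ 4)\<^sup>2)" for \<epsilon> :: real
  have N: "N \<epsilon> > 0" "real (N \<epsilon>) \<ge> \<epsilon> powr (- 4 / \<delta>)" if "\<epsilon> > 0" for \<epsilon>
    using that unfolding N_def by (simp_all add: real_nat_ceiling_ge)
  have pos: "\<forall>\<^sub>F \<epsilon>::real in at_right 0. \<epsilon> > 0" by (simp add: eventually_at_right_less)
  have t_pos: "t \<epsilon> > 0" if "\<epsilon> > 0" for \<epsilon>
    using that sqrt_four_plus_pos[of "\<epsilon> ^ 4"] by (simp add: t_def)
  have t_le: "t \<epsilon> \<le> pi * \<epsilon>\<^sup>2" if "\<epsilon> > 0" for \<epsilon>
  proof -
    have "1 \<le> sqrt (4 + (\<epsilon> ^ 4)\<^sup>2)" by (simp add: real_le_rsqrt)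
    from divide_left_mono[OF this, of "pi * \<epsilon>\<^sup>2"] show ?thesis by (simp add: t_def add_pos_nonneg)
  qed
  have "(t \<longlongrightarrow> 0) (at_right 0)"
  proof (rule tendsto_sandwich)
    show "\<forall>\<^sub>F \<epsilon> in at_right 0. 0 \<le> t \<epsilon>" "\<forall>\<^sub>F \<epsilon> in at_right 0. t \<epsilon> \<le> pi * \<epsilon>\<^sup>2"
      by (rule eventually_mono[OF pos], use t_pos t_le in force)+
    show "((\<lambda>\<epsilon>. pi * \<epsilon>\<^sup>2) \<longlongrightarrow> 0) (at_right 0)" by (auto intro!: tendsto_eq_intros)
  qed simp
  moreover have "((\<lambda>\<epsilon>. sobolev_norm (- \<delta>) (v \<epsilon> 0)) \<longlongrightarrow> 0) (at_right 0)"
  proof (rule tendsto_sandwich)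
    have bounds: "0 \<le> sobolev_norm (- \<delta>) (v \<epsilon> 0) \<and> sobolev_norm (- \<delta>) (v \<epsilon> 0) \<le> sqrt 2 * \<epsilon>" if "\<epsilon> > 0" for \<epsilon>
    proof -
      define M where "M = \<epsilon> powr (- 4 / \<delta>)"
      have M: "M > 0" "real (N \<epsilon>) \<ge> M" using N[OF that] that by (simp_all add: M_def)
      have "(1 + (real (N \<epsilon>))\<^sup>2) powr (- \<delta>) \<le> (M\<^sup>2) powr (- \<delta>)"
      proof (rule powr_mono2')
        have "M\<^sup>2 \<le> (real (N \<epsilon>))\<^sup>2" using M by (intro power_mono) auto
        then show "M\<^sup>2 \<le> 1 + (real (N \<epsilon>))\<^sup>2" by simp
      qed (use M assms in auto)
      also have "\<dots> = \<epsilon> ^ 8"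
      proof -
        have "(M\<^sup>2) powr (- \<delta>) = (M powr 2) powr (- \<delta>)" using M by (simp add: powr_numeral)
        also have "\<dots> = \<epsilon> powr 8" using assms by (simp add: M_def powr_powr)
        also have "\<dots> = \<epsilon> ^ 8" using that by (simp add: powr_numeral)
        finally show ?thesis .
      qed
      finally have weight: "(1 + (real (N \<epsilon>))\<^sup>2) powr (- \<delta>) \<le> \<epsilon> ^ 8" .
      have "sobolev_norm (- \<delta>) (v \<epsilon> 0) =
          sqrt ((1 + (real (N \<epsilon>))\<^sup>2) powr (- \<delta>) * (1 / \<epsilon> ^ 3)\<^sup>2 + \<epsilon>\<^sup>2)"
        unfolding v_def rescaled_orbit_initial sobolev_norm_binomial[OF N(1)[OF that]]
        using that by (simp only: norm_of_real power2_abs) (simp add: field_simps eval_nat_numeral)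
      moreover have "(1 + (real (N \<epsilon>))\<^sup>2) powr (- \<delta>) * (1 / \<epsilon> ^ 3)\<^sup>2 \<le> \<epsilon> ^ 8 * (1 / \<epsilon> ^ 3)\<^sup>2"
        by (intro mult_right_mono weight) simp
      moreover have "\<epsilon> ^ 8 * (1 / \<epsilon> ^ 3)\<^sup>2 = \<epsilon>\<^sup>2"
        using that by (simp add: field_simps eval_nat_numeral)
      ultimately have "sobolev_norm (- \<delta>) (v \<epsilon> 0) \<le> sqrt (2 * \<epsilon>\<^sup>2)" "0 \<le> sobolev_norm (- \<delta>) (v \<epsilon> 0)"
        by simp_all
      then show ?thesis using that by (simp add: real_sqrt_mult)
    qed
    show "\<forall>\<^sub>F \<epsilon> in at_right 0. 0 \<le> sobolev_norm (- \<delta>) (v \<epsilon> 0)"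
      "\<forall>\<^sub>F \<epsilon> in at_right 0. sobolev_norm (- \<delta>) (v \<epsilon> 0) \<le> sqrt 2 * \<epsilon>"
      by (rule eventually_mono[OF pos], use bounds in blast)+
    show "((\<lambda>\<epsilon>. sqrt 2 * \<epsilon>) \<longlongrightarrow> 0) (at_right 0)" by (auto intro!: tendsto_eq_intros)
  qed simp
  moreover have "filterlim (\<lambda>\<epsilon>. cmod (circle_inner (v \<epsilon> (t \<epsilon>)) (\<lambda>_. 1))) at_top (at_right 0)"
  proof (rule filterlim_at_top_mono)
    show "filterlim (\<lambda>\<epsilon>::real. inverse (\<epsilon> ^ 3)) at_top (at_right 0)"
    proof (rule filterlim_compose[OF filterlim_inverse_at_top_right])
      show "filterlim (\<lambda>\<epsilon>::real. \<epsilon> ^ 3) (at_right 0) (at_right 0)"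
        using pos by (auto simp: filterlim_at intro!: tendsto_eq_intros elim: eventually_mono)
    qed
    have "inverse (\<epsilon> ^ 3) \<le> cmod (circle_inner (v \<epsilon> (t \<epsilon>)) (\<lambda>_. 1))" if "\<epsilon> > 0" for \<epsilon>
    proof -
      have "(1 / \<epsilon> ^ 3)\<^sup>2 * t \<epsilon> = pi / (\<epsilon> ^ 4 * sqrt (4 + (\<epsilon> ^ 4)\<^sup>2))"
        using that sqrt_four_plus_pos[of "\<epsilon> ^ 4"] by (simp add: t_def field_simps eval_nat_numeral)
      then have "cmod (circle_inner (v \<epsilon> (t \<epsilon>)) (\<lambda>_. 1))
          = inverse (\<epsilon> ^ 3) * cmod (orbit_shift (\<epsilon> ^ 4) (pi / (\<epsilon> ^ 4 * sqrt (4 + (\<epsilon> ^ 4)\<^sup>2))))"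
        unfolding v_def using that N[OF that]
        by (subst mean_rescaled_orbit) (simp_all add: inverse_eq_divide)
      moreover have "1 \<le> cmod (orbit_shift (\<epsilon> ^ 4) (pi / (\<epsilon> ^ 4 * sqrt (4 + (\<epsilon> ^ 4)\<^sup>2))))"
        using that by (intro cmod_orbit_shift_peak) simp
      ultimately show ?thesis using that
        by (metis mult.right_neutral mult_left_mono inverse_nonnegative_iff_nonnegative less_imp_le zero_le_power)
    qed
    then show "\<forall>\<^sub>F \<epsilon> in at_right 0. inverse (\<epsilon> ^ 3) \<le> cmod (circle_inner (v \<epsilon> (t \<epsilon>)) (\<lambda>_. 1))"
      using pos by (rule eventually_mono[rotated])
  qed
  moreover have "\<forall>\<epsilon>>0. smooth_szego_solution (v \<epsilon>) \<and> (\<forall>s. rational_on_circle (v \<epsilon> s)) \<and> t \<epsilon> > 0"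
    using N t_pos by (auto simp: v_def intro!: smooth_szego_solution_rescaled_orbit rational_rescaled_orbit)
  ultimately show ?thesis by blast
qed

end
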